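(* Let $m\in\mathbb{N}$ and let $X$ be an integer-valued random variable with probability generating function $$\mathcal{P}(z)=\frac{1-\sqrt{1-z^{2m}}}{z^m}.$$ Then $X$ is positive discrete stable in the second sense (with the portlying operator given by $\mathcal{Q}_n(z)=\left(1/T_n(z^{-m})\right)^{1/m}$, $n\in\mathbb{N}$).
   Context: $\mathbb{N}=\{1,2,\dots\}$; generating functions are considered for $z\in(0,1]$. A non-negative integer-valued random variable $X$ is positive discrete stable in the second sense if for every $n\in\mathbb{N}$ there is a constant $p_n>0$ such that $$\sum_{j=1}^{X}\varepsilon_j(p_n)\stackrel{d}{=}\sum_{i=1}^nX_i,$$ where $X_1,X_2,\dots$ are independent copies of $X$ and the $\varepsilon_j(p_n)$ are i.i.d. non-negative integer-valued random variables independent of $X$, with a distribution depending on the parameter $p_n$. Equivalently, $\mathcal{P}(\mathcal{Q}_{p_n}(z))=\mathcal{P}^n(z)$, where $\mathcal{P}(z)=\mathrm{E}z^X$ and $\mathcal{Q}_{p_n}(z)=\mathrm{E}z^{\varepsilon_1(p_n)}$. Here the family is taken with $p_n=n$ and $$\mathcal{Q}_n(z)=\left(\frac{1}{T_n(1/z^m)}\right)^{1/m},$$ where $T_n$ is the Chebyshev polynomial of the first kind ($T_n(\cos\theta)=\cos n\theta$); it is known that $\mathcal{Q}_n$ is the probability generating function of a non-negative integer-valued random variable. *)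

theory Defs
  imports "HOL-Probability.Probability" "HOL-Computational_Algebra.Polynomial"
begin

definition pgf :: "'a measure \<Rightarrow> ('a \<Rightarrow> int) \<Rightarrow> real \<Rightarrow> real" where
  "pgf M X z = (\<integral>\<omega>. z powi X \<omega> \<partial>M)"

fun chebyshev_T :: "nat \<Rightarrow> real poly" where
  "chebyshev_T 0 = 1"
| "chebyshev_T (Suc 0) = [:0, 1:]"
| "chebyshev_T (Suc (Suc n)) = [:0, 2:] * chebyshev_T (Suc n) - chebyshev_T n"

lemma poly_chebyshev_T_cos: "poly (chebyshev_T n) (cos t) = cos (real n * t)"
proof (induction n rule: chebyshev_T.induct)
  case (3 n)
  have "cos (real (Suc (Suc n)) * t) + cos (real n * t) = 2 * cos t * cos (real (Suc n) * t)"
    using cos_add[of "real (Suc n) * t" t] cos_diff[of "real (Suc n) * t" t]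
    by (simp add: algebra_simps)
  then have "cos (real (Suc (Suc n)) * t) =
      2 * cos t * cos (real (Suc n) * t) - cos (real n * t)" by linarith
  then show ?case
    by (simp only: chebyshev_T.simps poly_diff poly_mult 3) simp
qed auto

lemma chebyshev_T_unique:
  "p = chebyshev_T n \<longleftrightarrow> (\<forall>t. poly p (cos t) = cos (real n * t))"
proof
  assume *: "\<forall>t. poly p (cos t) = cos (real n * t)"
  have "poly (p - chebyshev_T n) x = 0" if "x \<in> {-1..1}" for x
  proof -
    have "cos (arccos x) = x" using that by simp
    then show ?thesis
      using *[rule_format, of "arccos x"] poly_chebyshev_T_cos[of n "arccos x"]
      by (simp only: poly_diff)
  qed
  then have "{-1..1} \<subseteq> {x. poly (p - chebyshev_T n) x = 0}" by blast
  moreover have "infinite {-1..1::real}" by (simp add: infinite_Icc)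
  ultimately have "infinite {x. poly (p - chebyshev_T n) x = 0}"
    by (rule infinite_super)
  then have "p - chebyshev_T n = 0"
    by (rule contrapos_np) (rule poly_roots_finite)
  then show "p = chebyshev_T n" by simp
qed (simp add: poly_chebyshev_T_cos)

(* Q_n(z); meant for n >= 1, m >= 1, 0 < z <= 1, where T_n(1/z^m) >= 1. *)
definition cheb_pgf :: "nat \<Rightarrow> nat \<Rightarrow> real \<Rightarrow> real" where
  "cheb_pgf m n z = (1 / poly (chebyshev_T n) (1 / z ^ m)) powr (1 / real m)"

(* Law of eps_1 + ... + eps_X, where X has law L, the eps_j are i.i.d. with law d, and X is
   independent of (eps_j): the coordinates of the product space realise the variables.
   L is meant to be concentrated on the non-negative integers. *)
definition thinned_law :: "nat pmf \<Rightarrow> int measure \<Rightarrow> int measure" where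
  "thinned_law d L =
     distr (L \<Otimes>\<^sub>M (\<Pi>\<^sub>M j\<in>{1::nat..}. measure_pmf d)) (count_space UNIV)
       (\<lambda>(x, \<epsilon>). \<Sum>j=1..nat x. int (\<epsilon> j))"

(* Law of X_1 + ... + X_n for independent X_i of common law L. *)
definition iid_sum_law :: "nat \<Rightarrow> int measure \<Rightarrow> int measure" where
  "iid_sum_law n L =
     distr (\<Pi>\<^sub>M i\<in>{1..n}. L) (count_space UNIV) (\<lambda>x. \<Sum>i=1..n. x i)"

(* Positive discrete stability in the second sense. The parametrised family of laws of the
   eps_j (law D p for parameter p) and the constants p_n are explicit arguments, so that one
   can say with respect to which portlying operator X is stable. X is integer-valued, and its
   non-negativity is an almost sure statement, hence part of the definition. *)
definition positive_discrete_stable2 ::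
    "(real \<Rightarrow> nat pmf) \<Rightarrow> (nat \<Rightarrow> real) \<Rightarrow> 'a measure \<Rightarrow> ('a \<Rightarrow> int) \<Rightarrow> bool" where
  "positive_discrete_stable2 D p M X \<longleftrightarrow>
     X \<in> measurable M (count_space UNIV) \<and> (AE \<omega> in M. X \<omega> \<ge> 0) \<and>
     (\<forall>n\<ge>1. p n > 0 \<and>
        thinned_law (D (p n)) (distr M (count_space UNIV) X) =
          iid_sum_law n (distr M (count_space UNIV) X))"

end

theory Submission
  imports Defs "HOL-Complex_Analysis.Cauchy_Integral_Formula" "HOL-Analysis.Generalised_Binomial_Theorem"
begin

text \<open>
  Put \<open>z\<^sup>m = 1 / cosh t\<close> with \<open>t \<ge> 0\<close>. Then \<open>\<P>(z) = cosh t - sinh t = exp (- t)\<close>, while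
  \<open>T\<^sub>n (cosh t) = cosh (n t)\<close> says that replacing \<open>z\<close> by \<open>\<Q>\<^sub>n(z)\<close> replaces \<open>t\<close> by \<open>n t\<close>. Hence
  \<open>\<P>(\<Q>\<^sub>n(z)) = exp (- n t) = \<P>(z)\<^sup>n\<close> (\<open>stable_pgf_cheb_pgf\<close>). The left side is the
  generating function of the thinned law (\<open>pgf_thinned_law\<close>), the right side that of the law of
  the independent sum (\<open>pgf_iid_sum_law\<close>), and a law on the non-negative integers is
  determined by its generating function on \<open>(0, 1]\<close> (\<open>pgf_unique\<close>).

  Two further points need an argument. The variable \<open>X\<close> is only known to be integer-valued, but a
  negative value would keep \<open>E z\<^sup>X\<close> away from \<open>0\<close> as \<open>z\<close> tends to \<open>0\<close>, whereas \<open>\<P>(z) \<le> z\<close>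
  (\<open>pgf_le_arg_imp_nonneg\<close>).

  And \<open>\<Q>\<^sub>n\<close> has to be a generating function (\<open>is_pgf_cheb_pgf\<close>). With \<open>w = z\<^sup>m\<close> and
  \<open>V\<^sub>k(w) = T\<^sub>k(1/w) / (w T\<^sub>k\<^sub>+\<^sub>1(1/w))\<close>, telescoping gives
  \<open>\<Q>\<^sub>n(z) = \<Prod>k<n. z V\<^sub>k(w)\<^sup>1\<^sup>/\<^sup>m\<close>, and the three-term recurrence of the Chebyshev polynomials
  becomes \<open>V\<^sub>k\<^sub>+\<^sub>1 = 1 / (2 - w\<^sup>2 V\<^sub>k)\<close> with \<open>V\<^sub>0 = 1\<close>. For every \<open>a > 0\<close> the function
  \<open>x \<mapsto> (2 - x)\<^sup>-\<^sup>a\<close> is the generating function of a negative binomial law. Since generating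
  functions are closed under products and compositions, all powers \<open>V\<^sub>k(z\<^sup>m)\<^sup>a\<close>, and with them
  \<open>\<Q>\<^sub>n\<close>, are generating functions.
\<close>

section \<open>Generating functions determine laws on the non-negative integers\<close>

lemma powi_nonneg_le_one: "0 < z \<Longrightarrow> z \<le> 1 \<Longrightarrow> 0 \<le> k \<Longrightarrow> z powi k \<le> (1::real)"
  by (cases k) (auto simp: power_le_one)

lemma pgf_sums:
  assumes "\<bar>z\<bar> \<le> 1"
  shows "(\<lambda>k. pmf p k * z ^ k) sums pgf (measure_pmf p) int z"
proof -
  have "integrable (measure_pmf p) (\<lambda>k. z ^ k)"
    by (rule measure_pmf.integrable_const_bound[of _ 1])
       (use assms in \<open>auto simp: power_abs power_le_one\<close>)
  then have "integrable (count_space UNIV) (\<lambda>k. pmf p k * z ^ k)"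
    by (simp add: measure_pmf_eq_density integrable_density)
  then have "(\<lambda>k. pmf p k * z ^ k) sums (\<integral>k. pmf p k * z ^ k \<partial>count_space UNIV)"
    by (rule sums_integral_count_space_nat)
  also have "(\<integral>k. pmf p k * z ^ k \<partial>count_space UNIV) = pgf (measure_pmf p) int z"
    by (simp add: pgf_def measure_pmf_eq_density integral_density)
  finally show ?thesis .
qed

text \<open>
  The difference of the two generating functions is a power series that vanishes on \<open>(0, 1]\<close>, so
  its zeros accumulate at \<open>0\<close> and all its coefficients are zero.
\<close>

lemma pgf_unique_nat:
  assumes "\<And>z. z \<in> {0<..1} \<Longrightarrow> pgf (measure_pmf p) int z = pgf (measure_pmf q) int z"
  shows "p = q"
proof (rule pmf_eqI)
  define a where "a k = pmf p k - pmf q k" for k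
  define f where "f z = pgf (measure_pmf p) int z - pgf (measure_pmf q) int z" for z
  have sums: "(\<lambda>k. a k * z ^ k) sums f z" if "\<bar>z\<bar> < 1" for z
    using sums_diff[OF pgf_sums[of z p] pgf_sums[of z q]] that
    by (simp add: a_def f_def algebra_simps)
  have zero: "f z = 0" if "0 < z" "z \<le> 1" for z
    using assms[of z] that by (simp add: f_def)
  have "(f \<longlongrightarrow> a 0) (at 0)"
    by (rule powser_limit_0[of 1]) (use sums in auto)
  then have "(f \<longlongrightarrow> a 0) (at_right 0)"
    by (rule filterlim_at_split[THEN iffD1, THEN conjunct2])
  moreover have "(f \<longlongrightarrow> 0) (at_right 0)"
    by (rule tendsto_eventually) (auto simp: eventually_at_right_field intro!: exI[of _ 1] zero)
  ultimately have a0: "a 0 = 0"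
    by (rule tendsto_unique[rotated]) simp
  have "f 0 = 0"
    using sums[of 0] a0 by simp
  have "a k = 0" for k
  proof (rule ccontr)
    assume "a k \<noteq> 0"
    moreover from this have "k > 0" using a0 by (cases k) auto
    ultimately obtain s where "0 < s" and s: "\<And>z. z \<in> cball 0 s - {0} \<Longrightarrow> f z \<noteq> 0"
      using powser_0_nonzero[of 1 0 a f k] sums \<open>f 0 = 0\<close> by auto
    then show False
      using s[of "min s 1"] zero[of "min s 1"] by auto
  qed
  then show "pmf p k = pmf q k" for k
    by (simp add: a_def)
qed

text \<open>
  Turns the law of an integer variable, given as a measure, into a mass function on the natural
  numbers, for which the expectation is a power series.
\<close>

lemma nonneg_law_is_nat_pmf:
  assumes "prob_space L" "sets L = UNIV" "AE x in L. 0 \<le> x"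
  shows "\<exists>p. L = measure_pmf (map_pmf int p)"
proof -
  interpret prob_space L by fact
  have "AE x in L. measure L {x} \<noteq> 0"
  proof -
    have "AE x in L. x = y \<longrightarrow> measure L {y} \<noteq> 0" for y
    proof (cases "measure L {y} = 0")
      case True
      then have "{y} \<in> null_sets L"
        using assms(2) by (auto simp: null_sets_def emeasure_eq_measure)
      from AE_not_in[OF this] show ?thesis by eventually_elim auto
    qed auto
    then have "AE x in L. \<forall>y. x = y \<longrightarrow> measure L {y} \<noteq> 0"
      by (subst AE_all_countable) auto
    then show ?thesis by simp
  qed
  then have L: "measure_pmf (Abs_pmf L) = L"
    by (intro Abs_pmf_inverse) (use assms in auto)
  then have "\<forall>x\<in>set_pmf (Abs_pmf L). 0 \<le> x"
    using assms(3) by (metis AE_measure_pmf_iff)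
  then have "map_pmf int (map_pmf nat (Abs_pmf L)) = Abs_pmf L"
    by (auto simp: pmf.map_comp intro!: map_pmf_idI)
  then show ?thesis
    using L by metis
qed

lemma pgf_unique:
  assumes "prob_space L" "sets L = UNIV" "AE x in L. 0 \<le> x"
    and "prob_space L'" "sets L' = UNIV" "AE x in L'. 0 \<le> x"
    and "\<And>z. z \<in> {0<..1} \<Longrightarrow> pgf L id z = pgf L' id z"
  shows "L = L'"
proof -
  obtain p q where L: "L = measure_pmf (map_pmf int p)" "L' = measure_pmf (map_pmf int q)"
    using nonneg_law_is_nat_pmf assms by metis
  have "p = q"
    by (rule pgf_unique_nat) (use assms(7) L in \<open>simp add: pgf_def\<close>)
  with L show ?thesis by simp
qed

lemma pgf_bounds:
  assumes "z \<in> {0<..1}"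
  shows "pgf (measure_pmf p) int z \<in> {0<..1}"
proof -
  have int: "integrable (measure_pmf p) (\<lambda>k. z ^ k)"
    by (rule measure_pmf.integrable_const_bound[of _ 1])
       (use assms in \<open>auto simp: power_abs power_le_one\<close>)
  have "(\<integral>k. z ^ k \<partial>measure_pmf p) \<le> (\<integral>k. 1 \<partial>measure_pmf p)"
    by (rule integral_mono[OF int]) (use assms in \<open>auto simp: power_le_one\<close>)
  moreover have "(\<integral>k. 0 \<partial>measure_pmf p) < (\<integral>k. z ^ k \<partial>measure_pmf p)"
    by (rule measure_pmf.integral_less_AE_space[OF _ int]) (use assms in auto)
  ultimately show ?thesis by (simp add: pgf_def)
qed

section \<open>Generating functions of the thinned law and of independent sums\<close>

text \<open>
  Independence turns the power of a sum into a product of expectations. The index set of the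
  product space may be infinite, because the thinning operation draws on an infinite sequence of
  which only a random finite initial part is used.
\<close>

lemma pgf_sum_iid:
  assumes "prob_space N" "Y \<in> measurable N (count_space UNIV)" "finite J" "J \<subseteq> I" "z > 0"
    and "integrable N (\<lambda>x. z powi Y x)"
  shows "pgf (PiM I (\<lambda>_. N)) (\<lambda>x. \<Sum>j\<in>J. Y (x j)) z = pgf N Y z ^ card J"
proof -
  interpret N: prob_space N by fact
  interpret P: product_prob_space "\<lambda>_. N" I by unfold_locales
  have powi_sum: "z powi (\<Sum>j\<in>J. Y (x j)) = (\<Prod>j\<in>J. z powi Y (x j))" for x
    using \<open>finite J\<close> by induction (use \<open>z > 0\<close> in \<open>auto simp: power_int_add\<close>)
  have [measurable]: "Y \<in> measurable N (count_space UNIV)" by fact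
  have "pgf (PiM I (\<lambda>_. N)) (\<lambda>x. \<Sum>j\<in>J. Y (x j)) z
      = (\<integral>x. (\<Prod>j\<in>J. z powi Y (restrict x J j)) \<partial>PiM I (\<lambda>_. N))"
    by (simp add: pgf_def powi_sum)
  also have "\<dots> = (\<integral>x. (\<Prod>j\<in>J. z powi Y (x j)) \<partial>distr (PiM I (\<lambda>_. N)) (PiM J (\<lambda>_. N)) (\<lambda>x. restrict x J))"
  proof (rule integral_distr[symmetric])
    show "(\<lambda>x. restrict x J) \<in> measurable (PiM I (\<lambda>_. N)) (PiM J (\<lambda>_. N))"
      using \<open>J \<subseteq> I\<close> by (rule measurable_restrict_subset)
  qed measurable
  also have "\<dots> = (\<Prod>j\<in>J. \<integral>x. z powi Y x \<partial>N)"
    using P.product_integral_prod[OF \<open>finite J\<close>, of "\<lambda>_ x. z powi Y x"] assms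
    by (simp add: P.distr_PiM_restrict_finite)
  finally show ?thesis by (simp add: pgf_def)
qed

lemma measurable_int_sum:
  assumes "finite J" "\<And>j. j \<in> J \<Longrightarrow> f j \<in> measurable N (count_space (UNIV :: int set))"
  shows "(\<lambda>x. \<Sum>j\<in>J. f j x) \<in> measurable N (count_space UNIV)"
  using assms
proof (induction J)
  case (insert j J)
  have [measurable]: "f j \<in> measurable N (count_space UNIV)"
      "(\<lambda>x. \<Sum>j\<in>J. f j x) \<in> measurable N (count_space UNIV)"
    using insert by auto
  have "(\<lambda>x. f j x + (\<Sum>j\<in>J. f j x)) \<in> measurable N (count_space UNIV)"
    by (rule measurable_compose_countable[where f = "\<lambda>i x. i + (\<Sum>j\<in>J. f j x)" and g = "f j"]) measurable
  with insert show ?case by simp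
qed simp

lemma measurable_thinned_sum:
  "(\<lambda>(x, \<epsilon>). \<Sum>j=1..nat x. int (\<epsilon> j)) \<in>
     measurable (measure_pmf q \<Otimes>\<^sub>M (\<Pi>\<^sub>M j\<in>{1::nat..}. measure_pmf d)) (count_space (UNIV::int set))"
proof -
  have sum: "(\<lambda>\<epsilon>. \<Sum>j=1..nat x. int (\<epsilon> j)) \<in>
      measurable (\<Pi>\<^sub>M j\<in>{1::nat..}. measure_pmf d) (count_space UNIV)" for x
  proof (rule measurable_int_sum)
    fix j assume "j \<in> {1..nat x}"
    then have "j \<in> {1..}" by simp
    from measurable_component_singleton[OF this, of "\<lambda>_. measure_pmf d"]
    show "(\<lambda>\<epsilon>. int (\<epsilon> j)) \<in> measurable (\<Pi>\<^sub>M j\<in>{1::nat..}. measure_pmf d) (count_space UNIV)"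
      by (rule measurable_compose) simp
  qed simp
  have "(\<lambda>(x, \<epsilon>). \<Sum>j=1..nat x. int (\<epsilon> j)) \<in> measurable
      (count_space UNIV \<Otimes>\<^sub>M (\<Pi>\<^sub>M j\<in>{1::nat..}. measure_pmf d)) (count_space (UNIV::int set))"
    by (rule measurable_pair_measure_countable1) (use sum in auto)
  moreover have "sets (measure_pmf q \<Otimes>\<^sub>M (\<Pi>\<^sub>M j\<in>{1::nat..}. measure_pmf d)) =
      sets (count_space UNIV \<Otimes>\<^sub>M (\<Pi>\<^sub>M j\<in>{1::nat..}. measure_pmf d))"
    by (rule sets_pair_measure_cong) simp_all
  ultimately show ?thesis
    by (simp cong: measurable_cong_sets)
qed

text \<open>
  Conditionally on \<open>X = x\<close>, the generating function of the sum is the \<open>x\<close>-th power of that of one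
  summand; integrating over \<open>x\<close> evaluates the generating function of \<open>X\<close> there.
\<close>

lemma pgf_thinned_law:
  assumes "z \<in> {0<..1}" "\<forall>x\<in>set_pmf q. 0 \<le> x"
  shows "pgf (thinned_law d (measure_pmf q)) id z = pgf (measure_pmf q) id (pgf (measure_pmf d) int z)"
proof -
  let ?P = "\<Pi>\<^sub>M j\<in>{1::nat..}. measure_pmf d"
  define S where "S = (\<lambda>(x, \<epsilon>). \<Sum>j=1..nat x. int (\<epsilon> j))"
  interpret P: prob_space ?P by (intro prob_space_PiM measure_pmf.prob_space_axioms)
  interpret QP: pair_prob_space "measure_pmf q" ?P ..
  note [measurable] = measurable_thinned_sum[of q d, folded S_def]
  have S_nonneg: "0 \<le> S \<omega>" for \<omega>
    by (auto simp: S_def split_beta intro: sum_nonneg)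
  have int: "integrable (measure_pmf q \<Otimes>\<^sub>M ?P) (\<lambda>\<omega>. z powi S \<omega>)"
  proof (rule QP.integrable_const_bound[of _ 1])
    show "AE \<omega> in measure_pmf q \<Otimes>\<^sub>M ?P. norm (z powi S \<omega>) \<le> 1"
      using assms(1) powi_nonneg_le_one[OF _ _ S_nonneg] by (auto simp: power_int_abs)
  qed measurable
  have "pgf (thinned_law d (measure_pmf q)) id z = (\<integral>\<omega>. z powi S \<omega> \<partial>(measure_pmf q \<Otimes>\<^sub>M ?P))"
    unfolding pgf_def thinned_law_def S_def[symmetric] by (subst integral_distr) (simp_all only: measurable_count_space_eq1 id_apply, measurable)
  also have "\<dots> = (\<integral>x. \<integral>\<epsilon>. z powi S (x, \<epsilon>) \<partial>?P \<partial>measure_pmf q)"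
    by (rule QP.integral_fst'[symmetric]) (rule int)
  also have "\<dots> = (\<integral>x. pgf (measure_pmf d) int z powi x \<partial>measure_pmf q)"
  proof (intro integral_cong_AE AE_pmfI)
    fix x assume "x \<in> set_pmf q"
    then have "x = int (nat x)" using assms(2) by simp
    moreover have "integrable (measure_pmf d) (\<lambda>k. z powi int k)"
      by (rule measure_pmf.integrable_const_bound[of _ 1])
         (use assms in \<open>auto simp: power_abs power_le_one\<close>)
    then have "pgf ?P (\<lambda>\<epsilon>. \<Sum>j=1..nat x. int (\<epsilon> j)) z = pgf (measure_pmf d) int z ^ card {1..nat x}"
      using assms(1) by (intro pgf_sum_iid measure_pmf.prob_space_axioms) auto
    ultimately show "(\<integral>\<epsilon>. z powi S (x, \<epsilon>) \<partial>?P) = pgf (measure_pmf d) int z powi x"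
      by (metis (no_types, lifting) S_def card_atLeastAtMost diff_Suc_1 case_prod_conv pgf_def power_int_of_nat Bochner_Integration.integral_cong)
  qed auto
  finally show ?thesis by (simp add: pgf_def)
qed

lemma
  shows prob_space_thinned_law: "prob_space (thinned_law d (measure_pmf q))"
    and sets_thinned_law: "sets (thinned_law d (measure_pmf q)) = UNIV"
    and AE_thinned_law_nonneg: "AE x in thinned_law d (measure_pmf q). 0 \<le> x"
proof -
  let ?P = "\<Pi>\<^sub>M j\<in>{1::nat..}. measure_pmf d"
  interpret P: prob_space ?P by (intro prob_space_PiM measure_pmf.prob_space_axioms)
  interpret QP: pair_prob_space "measure_pmf q" ?P ..
  show "prob_space (thinned_law d (measure_pmf q))"
    unfolding thinned_law_def by (rule QP.prob_space_distr[OF measurable_thinned_sum])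
  show "sets (thinned_law d (measure_pmf q)) = UNIV"
    by (simp add: thinned_law_def)
  show "AE x in thinned_law d (measure_pmf q). 0 \<le> x"
    unfolding thinned_law_def by (subst AE_distr_iff[OF measurable_thinned_sum]) (auto intro!: AE_I2 sum_nonneg)
qed

lemma
  assumes "\<forall>x\<in>set_pmf q. 0 \<le> x"
  shows prob_space_iid_sum_law: "prob_space (iid_sum_law n (measure_pmf q))"
    and sets_iid_sum_law: "sets (iid_sum_law n (measure_pmf q)) = UNIV"
    and AE_iid_sum_law_nonneg: "AE x in iid_sum_law n (measure_pmf q). 0 \<le> x"
    and pgf_iid_sum_law:
      "z \<in> {0<..1} \<Longrightarrow> pgf (iid_sum_law n (measure_pmf q)) id z = pgf (measure_pmf q) id z ^ n"
proof -
  let ?P = "\<Pi>\<^sub>M j\<in>{1..n}. measure_pmf q"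
  interpret P: prob_space ?P by (intro prob_space_PiM measure_pmf.prob_space_axioms)
  have sum_measurable [measurable]: "(\<lambda>x. \<Sum>i=1..n. x i) \<in> measurable ?P (count_space UNIV)"
  proof (rule measurable_int_sum)
    fix i assume "i \<in> {1..n}"
    from measurable_component_singleton[OF this, of "\<lambda>_. measure_pmf q"]
    show "(\<lambda>x. x i) \<in> measurable ?P (count_space UNIV)" by simp
  qed simp
  show "prob_space (iid_sum_law n (measure_pmf q))"
    unfolding iid_sum_law_def by (rule P.prob_space_distr) measurable
  show "sets (iid_sum_law n (measure_pmf q)) = UNIV"
    by (simp add: iid_sum_law_def)
  have "AE x in ?P. \<forall>i\<in>{1..n}. 0 \<le> x i"
    using assms by (intro AE_finite_allI AE_PiM_component measure_pmf.prob_space_axioms AE_pmfI) auto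
  then show "AE x in iid_sum_law n (measure_pmf q). 0 \<le> x"
    unfolding iid_sum_law_def
    by (subst AE_distr_iff[OF sum_measurable]) (auto elim!: eventually_mono intro!: sum_nonneg)
  show "pgf (iid_sum_law n (measure_pmf q)) id z = pgf (measure_pmf q) id z ^ n" if "z \<in> {0<..1}"
  proof -
    have "integrable (measure_pmf q) (\<lambda>k. z powi k)"
      by (rule measure_pmf.integrable_const_bound[of _ 1])
         (use assms that powi_nonneg_le_one[of z] in \<open>auto intro!: AE_pmfI simp: power_int_abs\<close>)
    then have "pgf ?P (\<lambda>x. \<Sum>i=1..n. id (x i)) z = pgf (measure_pmf q) id z ^ card {1..n}"
      using that by (intro pgf_sum_iid measure_pmf.prob_space_axioms) auto
    then show ?thesis
      unfolding iid_sum_law_def pgf_def by (subst integral_distr[OF sum_measurable]) auto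
  qed
qed

section \<open>Operations on generating functions\<close>

definition is_pgf :: "(real \<Rightarrow> real) \<Rightarrow> bool" where
  "is_pgf f \<longleftrightarrow> (\<exists>p :: nat pmf. \<forall>z\<in>{0<..1}. pgf (measure_pmf p) int z = f z)"

lemma is_pgf_cong: "is_pgf f \<Longrightarrow> (\<And>z. z \<in> {0<..1} \<Longrightarrow> f z = g z) \<Longrightarrow> is_pgf g"
  by (simp add: is_pgf_def)

lemma is_pgf_power_series:
  assumes nonneg: "\<And>k. 0 \<le> c k"
    and sums: "\<And>z. z \<in> {0<..1} \<Longrightarrow> (\<lambda>k. c k * z ^ k) sums f z" and "f 1 = 1"
  shows "is_pgf f"
proof -
  have "c sums 1"
    using sums[of 1] \<open>f 1 = 1\<close> by simp
  then have "(\<Sum>k. ennreal (c k)) = ennreal 1"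
    by (intro suminf_ennreal_eq nonneg)
  then have "pmf (embed_pmf c) k = c k" for k
    by (intro pmf_embed_pmf) (auto simp: nonneg nn_integral_count_space_nat)
  then have "pgf (measure_pmf (embed_pmf c)) int z = f z" if "z \<in> {0<..1}" for z
    using pgf_sums[of z "embed_pmf c"] sums[OF that] that by (auto intro: sums_unique2)
  then show ?thesis
    unfolding is_pgf_def by blast
qed

lemma is_pgf_one: "is_pgf (\<lambda>z. 1)"
  unfolding is_pgf_def by (intro exI[of _ "return_pmf 0"]) (simp add: pgf_def)

lemma is_pgf_id: "is_pgf (\<lambda>z. z)"
  unfolding is_pgf_def by (intro exI[of _ "return_pmf 1"]) (simp add: pgf_def)

lemma is_pgf_mult:
  assumes "is_pgf f" "is_pgf g"
  shows "is_pgf (\<lambda>z. f z * g z)"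
proof -
  obtain p q where p: "\<And>z. z \<in> {0<..1} \<Longrightarrow> pgf (measure_pmf p) int z = f z"
    and q: "\<And>z. z \<in> {0<..1} \<Longrightarrow> pgf (measure_pmf q) int z = g z"
    using assms unfolding is_pgf_def by metis
  have "pgf (measure_pmf r) int 1 = 1" for r :: "nat pmf"
    by (simp add: pgf_def)
  then have "f 1 * g 1 = 1"
    using p[of 1] q[of 1] by auto
  moreover have "(\<lambda>k. (\<Sum>i\<le>k. pmf p i * pmf q (k - i)) * z ^ k) sums (f z * g z)" if z: "z \<in> {0<..1}" for z
  proof -
    have p': "(\<lambda>k. pmf p k * z ^ k) sums f z" and q': "(\<lambda>k. pmf q k * z ^ k) sums g z"
      using pgf_sums[of z p] pgf_sums[of z q] p[OF z] q[OF z] z by auto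
    have "(\<lambda>k. \<Sum>i\<le>k. (pmf p i * z ^ i) * (pmf q (k - i) * z ^ (k - i))) sums
        ((\<Sum>k. pmf p k * z ^ k) * (\<Sum>k. pmf q k * z ^ k))"
      by (rule Cauchy_product_sums) (use z p' q' in \<open>auto simp: sums_iff abs_mult\<close>)
    moreover have "(\<Sum>i\<le>k. (pmf p i * z ^ i) * (pmf q (k - i) * z ^ (k - i))) =
        (\<Sum>i\<le>k. pmf p i * pmf q (k - i)) * z ^ k" for k
      unfolding sum_distrib_right
      by (rule sum.cong) (auto simp flip: power_add)
    ultimately show ?thesis
      using p' q' by (simp add: sums_iff)
  qed
  ultimately show ?thesis
    by (intro is_pgf_power_series[where c = "\<lambda>k. \<Sum>i\<le>k. pmf p i * pmf q (k - i)"])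
       (auto intro!: sum_nonneg)
qed

lemma is_pgf_power: "is_pgf f \<Longrightarrow> is_pgf (\<lambda>z. f z ^ n)"
  by (induction n) (auto intro: is_pgf_one is_pgf_mult)

text \<open>
  The composition is the generating function of a sum of independent summands whose number is
  random, which is what thinning produces.
\<close>

lemma is_pgf_compose:
  assumes "is_pgf f" "is_pgf g"
  shows "is_pgf (\<lambda>z. f (g z))"
proof -
  obtain p q where p: "\<And>z. z \<in> {0<..1} \<Longrightarrow> pgf (measure_pmf p) int z = f z"
    and q: "\<And>z. z \<in> {0<..1} \<Longrightarrow> pgf (measure_pmf q) int z = g z"
    using assms unfolding is_pgf_def by metis
  obtain r where r: "thinned_law q (measure_pmf (map_pmf int p)) = measure_pmf (map_pmf int r)"
    using nonneg_law_is_nat_pmf prob_space_thinned_law sets_thinned_law AE_thinned_law_nonneg by blast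
  have "pgf (measure_pmf r) int z = f (g z)" if z: "z \<in> {0<..1}" for z
  proof -
    have "pgf (measure_pmf r) int z = pgf (measure_pmf (map_pmf int r)) id z"
      by (simp add: pgf_def)
    also have "\<dots> = pgf (measure_pmf (map_pmf int p)) id (g z)"
      using pgf_thinned_law[OF z, of "map_pmf int p" q] q[OF z] r by simp
    also have "\<dots> = f (g z)"
      using p[of "g z"] pgf_bounds[OF z, of q] q[OF z] by (simp add: pgf_def)
    finally show ?thesis .
  qed
  then show ?thesis
    unfolding is_pgf_def by blast
qed

text \<open>
  With parameters \<open>a\<close> and \<open>1/2\<close>. In the binomial series of \<open>(2 + y)\<^sup>-\<^sup>a\<close> at \<open>y = - z\<close> the sign
  of \<open>(- z)\<^sup>k\<close> cancels the sign of the generalised binomial coefficient, which leaves the rising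
  factorial.
\<close>

lemma is_pgf_negative_binomial:
  assumes "a > 0"
  shows "is_pgf (\<lambda>z. (2 - z) powr - a)"
proof (rule is_pgf_power_series)
  show "0 \<le> 2 powr (- a - real k) * (pochhammer a k / fact k)" for k
    using assms by (auto intro!: mult_nonneg_nonneg divide_nonneg_nonneg less_imp_le[OF pochhammer_pos])
  show "(\<lambda>k. 2 powr (- a - real k) * (pochhammer a k / fact k) * z ^ k) sums (2 - z) powr - a"
    if "z \<in> {0<..1}" for z
    using gen_binomial_real''[of "- z" 2 "- a"] that
    by (simp add: gbinomial_pochhammer power_minus[of z] mult_ac flip: power_add mult_2)
qed simp

section \<open>The Chebyshev thinning laws\<close>

lemma poly_chebyshev_T_cosh: "poly (chebyshev_T n) (cosh t) = cosh (real n * t)"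
proof (induction n rule: chebyshev_T.induct)
  case (3 n)
  have "cosh (real (Suc (Suc n)) * t) + cosh (real n * t) = 2 * cosh t * cosh (real (Suc n) * t)"
    using cosh_add[of "real (Suc n) * t" t] cosh_diff[of "real (Suc n) * t" t]
    by (simp add: algebra_simps)
  with 3 show ?case
    by simp
qed auto

lemma chebyshev_T_pos:
  assumes "x \<ge> 1"
  shows "poly (chebyshev_T n) x > 0"
  using poly_chebyshev_T_cosh[of n "arcosh x"] assms by simp

text \<open>
  The factor by which \<open>1 / T\<^sub>k(1/w)\<close> changes when \<open>k\<close> grows by one, divided by \<open>w\<close> to
  remove its zero at \<open>w = 0\<close>.
\<close>

definition cheb_ratio :: "nat \<Rightarrow> real \<Rightarrow> real" where
  "cheb_ratio k w = poly (chebyshev_T k) (1 / w) / (w * poly (chebyshev_T (Suc k)) (1 / w))"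

lemma cheb_ratio_pos: "w \<in> {0<..1} \<Longrightarrow> cheb_ratio k w > 0"
  using chebyshev_T_pos[of "1 / w"] by (simp add: cheb_ratio_def)

lemma cheb_ratio_Suc:
  assumes "w \<in> {0<..1}"
  shows "cheb_ratio (Suc k) w = 1 / (2 - w\<^sup>2 * cheb_ratio k w)"
proof -
  have "poly (chebyshev_T (Suc k)) (1 / w) > 0"
    using chebyshev_T_pos[of "1 / w"] assms by simp
  then have "w\<^sup>2 * cheb_ratio k w = w * poly (chebyshev_T k) (1 / w) / poly (chebyshev_T (Suc k)) (1 / w)"
    using assms by (simp add: cheb_ratio_def power2_eq_square)
  also have "2 - \<dots> = w * poly (chebyshev_T (Suc (Suc k))) (1 / w) / poly (chebyshev_T (Suc k)) (1 / w)"
    using assms \<open>poly (chebyshev_T (Suc k)) (1 / w) > 0\<close> by (simp add: field_simps)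
  finally show ?thesis
    by (simp add: cheb_ratio_def)
qed

text \<open>
  The exponent has to be arbitrary in the induction: the step for any \<open>a\<close> uses the induction
  hypothesis with exponent \<open>1\<close>, inside the negative binomial generating function with exponent
  \<open>a\<close>.
\<close>

lemma is_pgf_cheb_ratio:
  assumes "a > 0"
  shows "is_pgf (\<lambda>z. cheb_ratio k (z ^ m) powr a)"
  using assms
proof (induction k arbitrary: a)
  case 0
  show ?case
    by (rule is_pgf_cong[OF is_pgf_one]) (simp add: cheb_ratio_def)
next
  case (Suc k)
  have "is_pgf (\<lambda>z. cheb_ratio k (z ^ m))"
    by (rule is_pgf_cong[OF Suc.IH[of 1]])
       (use cheb_ratio_pos in \<open>auto simp: power_le_one intro!: abs_of_pos\<close>)
  then have "is_pgf (\<lambda>z. (2 - z ^ (2 * m) * cheb_ratio k (z ^ m)) powr - a)"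
    by (intro is_pgf_compose[OF is_pgf_negative_binomial] is_pgf_mult is_pgf_power is_pgf_id Suc.prems)
  then show ?case
  proof (rule is_pgf_cong)
    fix z :: real assume "z \<in> {0<..1}"
    then have "z ^ m \<in> {0<..1}" by (simp add: power_le_one)
    note eq = cheb_ratio_Suc[OF this] and pos = cheb_ratio_pos[OF this, of "Suc k"]
    have "cheb_ratio (Suc k) (z ^ m) powr a = inverse (2 - z ^ (2 * m) * cheb_ratio k (z ^ m)) powr a"
      using eq by (simp add: power_mult[symmetric] mult.commute inverse_eq_divide)
    then show "(2 - z ^ (2 * m) * cheb_ratio k (z ^ m)) powr - a = cheb_ratio (Suc k) (z ^ m) powr a"
      using pos eq by (simp add: powr_minus inverse_powr power_mult[symmetric] mult.commute)
  qed
qed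

lemma is_pgf_cheb_pgf:
  assumes "m \<ge> 1"
  shows "is_pgf (cheb_pgf m n)"
proof (induction n)
  case 0
  show ?case
    by (rule is_pgf_cong[OF is_pgf_one]) (simp add: cheb_pgf_def)
next
  case (Suc n)
  have "is_pgf (\<lambda>z. cheb_pgf m n z * (z * cheb_ratio n (z ^ m) powr (1 / real m)))"
    using assms by (intro is_pgf_mult Suc.IH is_pgf_id is_pgf_cheb_ratio) simp
  then show ?case
  proof (rule is_pgf_cong)
    fix z :: real assume z: "z \<in> {0<..1}"
    then have w: "z ^ m \<in> {0<..1}" by (simp add: power_le_one)
    then have pos: "poly (chebyshev_T k) (1 / z ^ m) > 0" for k
      by (intro chebyshev_T_pos) simp
    have "z = (z ^ m) powr (1 / real m)"
      using z assms by (simp add: powr_powr flip: powr_realpow)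
    then have "cheb_pgf m n z * (z * cheb_ratio n (z ^ m) powr (1 / real m)) =
        (1 / poly (chebyshev_T n) (1 / z ^ m) * (z ^ m * cheb_ratio n (z ^ m))) powr (1 / real m)"
      using w pos[of n] cheb_ratio_pos[OF w, of n] unfolding cheb_pgf_def
      by (subst powr_mult powr_mult; simp)+
    also have "1 / poly (chebyshev_T n) (1 / z ^ m) * (z ^ m * cheb_ratio n (z ^ m)) =
        1 / poly (chebyshev_T (Suc n)) (1 / z ^ m)"
      using z pos[of n] unfolding cheb_ratio_def by simp
    finally show "cheb_pgf m n z * (z * cheb_ratio n (z ^ m) powr (1 / real m)) = cheb_pgf m (Suc n) z"
      by (simp add: cheb_pgf_def)
  qed
qed

section \<open>The stable law\<close>

definition stable_pgf :: "nat \<Rightarrow> real \<Rightarrow> real" where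
  "stable_pgf m z = (1 - sqrt (1 - z ^ (2 * m))) / z ^ m"

lemma stable_pgf_sech:
  assumes "t \<ge> 0" "z ^ m = 1 / cosh t"
  shows "stable_pgf m z = exp (- t)"
proof -
  have "1 - z ^ (2 * m) = 1 - (1 / cosh t)\<^sup>2"
    using assms(2) by (metis mult.commute power_mult)
  also have "\<dots> = (sinh t / cosh t)\<^sup>2"
    using cosh_real_pos[of t] by (simp add: field_simps sinh_square_eq)
  finally have "sqrt (1 - z ^ (2 * m)) = sinh t / cosh t"
    using \<open>t \<ge> 0\<close> by simp
  then have "stable_pgf m z = cosh t - sinh t"
    using assms(2) cosh_real_pos[of t] by (simp add: stable_pgf_def left_diff_distrib)
  then show ?thesis
    by (simp add: cosh_minus_sinh)
qed

lemma stable_pgf_cheb_pgf: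
  assumes "m \<ge> 1" "z \<in> {0<..1}"
  shows "stable_pgf m (cheb_pgf m n z) = stable_pgf m z ^ n"
proof -
  define t where "t = arcosh (1 / z ^ m)"
  have "1 / z ^ m \<ge> 1"
    using assms(2) by (simp add: power_le_one)
  then have t: "t \<ge> 0" "z ^ m = 1 / cosh t"
    by (auto simp: t_def)
  have "cheb_pgf m n z = (1 / cosh (real n * t)) powr (1 / real m)"
    by (simp add: cheb_pgf_def t poly_chebyshev_T_cosh)
  then have "cheb_pgf m n z ^ m = 1 / cosh (real n * t)"
    using assms(1) cosh_real_pos[of "real n * t"] by (simp add: powr_powr flip: powr_realpow)
  then have "stable_pgf m (cheb_pgf m n z) = exp (- (real n * t))"
    using t by (intro stable_pgf_sech) simp_all
  also have "\<dots> = stable_pgf m z ^ n"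
    using stable_pgf_sech[OF t] by (simp flip: exp_of_nat_mult)
  finally show ?thesis .
qed

text \<open>
  The upper bound comes from \<open>sqrt (1 - u\<^sup>2) \<ge> 1 - u\<^sup>2\<close> with \<open>u = z\<^sup>m\<close>.
\<close>

lemma stable_pgf_bounds:
  assumes "m \<ge> 1" "z \<in> {0<..1}"
  shows "stable_pgf m z \<in> {0<..z}"
proof -
  define u where "u = z ^ m"
  have u: "0 < u" "u \<le> z" "u \<le> 1"
    using assms power_decreasing[of 1 m z] by (auto simp: u_def power_le_one)
  have eq: "stable_pgf m z = (1 - sqrt (1 - u\<^sup>2)) / u"
    by (simp add: stable_pgf_def u_def mult.commute flip: power_mult)
  have u2: "u\<^sup>2 \<le> 1"
    using u by (simp add: power_le_one)
  have "(1 - u\<^sup>2)\<^sup>2 \<le> 1 - u\<^sup>2"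
    using u2 by (simp add: power2_eq_square mult_left_le_one_le)
  then have "1 - u\<^sup>2 \<le> sqrt (1 - u\<^sup>2)"
    by (rule real_le_rsqrt)
  then have "(1 - sqrt (1 - u\<^sup>2)) / u \<le> u"
    using u by (simp add: field_simps power2_eq_square)
  moreover have "sqrt (1 - u\<^sup>2) < 1"
    using u by simp
  ultimately show ?thesis
    using u eq by simp
qed

text \<open>
  Where \<open>X < 0\<close>, the power \<open>z\<^sup>X\<close> is at least \<open>1\<close>, so the probability of this event is at most
  \<open>E z\<^sup>X \<le> z\<close> for every \<open>z\<close> in \<open>(0, 1]\<close>.
\<close>

lemma pgf_le_arg_imp_nonneg:
  assumes "prob_space M" and [measurable]: "X \<in> measurable M (count_space UNIV)"
    and bounds: "\<And>z. z \<in> {0<..1} \<Longrightarrow> pgf M X z \<in> {0<..z}"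
  shows "AE \<omega> in M. 0 \<le> X \<omega>"
proof -
  interpret prob_space M by fact
  let ?A = "{\<omega> \<in> space M. X \<omega> < 0}"
  have "prob ?A \<le> z" if z: "z \<in> {0<..1}" for z
  proof -
    \<comment> \<open>The integral of a non-integrable function is \<open>0\<close> by convention, which the strict lower bound excludes.\<close>
    have int: "integrable M (\<lambda>\<omega>. z powi X \<omega>)"
      using bounds[OF z] not_integrable_integral_eq[of M "\<lambda>\<omega>. z powi X \<omega>"] by (auto simp: pgf_def)
    have "prob ?A = (\<integral>\<omega>. indicator ?A \<omega> \<partial>M)"
      by simp
    also have "\<dots> \<le> (\<integral>\<omega>. z powi X \<omega> \<partial>M)"
    proof (rule integral_mono[OF _ int])
      show "integrable M (indicat_real ?A)"
        by (rule integrable_real_indicator) (auto simp: emeasure_eq_measure)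
      fix \<omega>
      show "indicator ?A \<omega> \<le> z powi X \<omega>"
        using z by (auto simp: indicator_def power_int_def one_le_inverse power_le_one)
    qed
    also have "\<dots> \<le> z"
      using bounds[OF z] by (simp add: pgf_def)
    finally show ?thesis .
  qed
  then have "prob ?A \<le> 0"
    by (intro dense_ge_bounded[of 0 1]) auto
  then have "prob ?A = 0"
    using measure_nonneg[of M ?A] by simp
  then have "AE \<omega> in M. \<not> X \<omega> < 0"
    by (subst (asm) prob_eq_0) auto
  then show ?thesis by eventually_elim simp
qed

theorem theorem2p21:
  fixes m :: nat and M :: "'a measure" and X :: "'a \<Rightarrow> int"
  assumes "m \<ge> 1"
    and "prob_space M"
    and "X \<in> measurable M (count_space UNIV)"
    and "\<And>z. z \<in> {0<..1} \<Longrightarrow> pgf M X z = (1 - sqrt (1 - z ^ (2 * m))) / z ^ m"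
  shows "\<exists>D :: real \<Rightarrow> nat pmf.
           (\<forall>n\<ge>1. \<forall>z\<in>{0<..1}. pgf (measure_pmf (D (real n))) int z = cheb_pgf m n z) \<and>
           positive_discrete_stable2 D real M X"
proof -
  interpret prob_space M by fact
  have pgf_X: "pgf M X z = stable_pgf m z" if "z \<in> {0<..1}" for z
    using assms(4)[OF that] by (simp add: stable_pgf_def)
  have X_nonneg: "AE \<omega> in M. 0 \<le> X \<omega>"
    using pgf_X stable_pgf_bounds[OF assms(1)]
    by (intro pgf_le_arg_imp_nonneg[OF assms(2,3)]) simp
  obtain d where d: "\<And>n z. z \<in> {0<..1} \<Longrightarrow> pgf (measure_pmf (d n)) int z = cheb_pgf m n z"
    using is_pgf_cheb_pgf[OF assms(1)] unfolding is_pgf_def by metis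
  let ?L = "distr M (count_space UNIV) X"
  have "\<exists>p. ?L = measure_pmf (map_pmf int p)"
    using assms(3) X_nonneg by (intro nonneg_law_is_nat_pmf prob_space_distr) (auto simp: AE_distr_iff)
  then obtain q where q: "?L = measure_pmf q" "\<forall>x\<in>set_pmf q. 0 \<le> x"
    by fastforce
  have pgf_q: "pgf (measure_pmf q) id z = stable_pgf m z" if "z \<in> {0<..1}" for z
    using pgf_X[OF that] assms(3) unfolding q(1)[symmetric] by (simp add: pgf_def integral_distr)
  have "thinned_law (d n) ?L = iid_sum_law n ?L" for n
    unfolding q(1)
  proof (rule pgf_unique)
    fix z :: real assume z: "z \<in> {0<..1}"
    have "cheb_pgf m n z \<in> {0<..1}"
      using pgf_bounds[OF z, of "d n"] d[OF z] by simp
    then have "pgf (thinned_law (d n) (measure_pmf q)) id z = stable_pgf m (cheb_pgf m n z)"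
      using pgf_thinned_law[OF z q(2)] d[OF z] pgf_q by simp
    also have "\<dots> = pgf (iid_sum_law n (measure_pmf q)) id z"
      using stable_pgf_cheb_pgf[OF assms(1) z] pgf_iid_sum_law[OF q(2) z] pgf_q[OF z] by simp
    finally show "pgf (thinned_law (d n) (measure_pmf q)) id z = pgf (iid_sum_law n (measure_pmf q)) id z" .
  qed (simp_all add: prob_space_thinned_law sets_thinned_law AE_thinned_law_nonneg
      prob_space_iid_sum_law sets_iid_sum_law AE_iid_sum_law_nonneg q(2))
  then have "positive_discrete_stable2 (\<lambda>p. d (nat \<lfloor>p\<rfloor>)) real M X"
    using assms(3) X_nonneg by (simp add: positive_discrete_stable2_def)
  then show ?thesis
    using d by (intro exI[of _ "\<lambda>p. d (nat \<lfloor>p\<rfloor>)"]) auto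
qed

end
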